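(* Let $G$ be a finite simple graph with distinguishing number $D(G)=2$ and determining number $Det(G)=2$. Then its cost number satisfies $2\le \rho(G)\le 4$.
   Context: For a graph $G$, $Aut(G)$ is its automorphism group. A vertex coloring $c:V(G)\to C$ (not necessarily proper) is distinguishing if the only automorphism $\varphi$ of $G$ with $c(\varphi(v))=c(v)$ for all $v$ is the identity. $D(G)$ is the least number of colors in a distinguishing coloring. A set $S\subseteq V(G)$ is a determining set if the only automorphism fixing every vertex of $S$ is the identity; $Det(G)$ is the minimum size of a determining set. If $D(G)=2$, a color class of a distinguishing coloring with 2 colors is called a distinguishing class, and the cost number $\rho(G)$ is the minimum size of a distinguishing class of $G$. *)

theory Defs
  imports
    "Graph_Theory.Digraph"
    "HOL-Combinatorics.Permutations"
    "HOL-Library.FuncSet"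
begin

text \<open>
  A finite simple graph is a \<^locale>\<open>graph\<close>: a finite symmetric digraph without loops and
  parallel arcs, an edge being a pair of opposite arcs. Since arcs are determined by their ends,
  an automorphism is given by its action on the vertices. Automorphisms are normalised to be the
  identity outside the vertex set, so that the trivial automorphism is \<^const>\<open>id\<close>.
\<close>

definition automorphisms :: "('a, 'b) pre_digraph \<Rightarrow> ('a \<Rightarrow> 'a) set" where
  "automorphisms G =
     {\<phi>. \<phi> permutes verts G \<and>
         (\<forall>u \<in> verts G. \<forall>v \<in> verts G. \<phi> u \<rightarrow>\<^bsub>G\<^esub> \<phi> v \<longleftrightarrow> u \<rightarrow>\<^bsub>G\<^esub> v)}"

definition distinguishing_coloring :: "('a, 'b) pre_digraph \<Rightarrow> ('a \<Rightarrow> 'c) \<Rightarrow> bool" where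
  "distinguishing_coloring G c \<longleftrightarrow>
     (\<forall>\<phi> \<in> automorphisms G. (\<forall>v \<in> verts G. c (\<phi> v) = c v) \<longrightarrow> \<phi> = id)"

definition distinguishing_number :: "('a, 'b) pre_digraph \<Rightarrow> nat" where
  "distinguishing_number G =
     (LEAST k. \<exists>c \<in> verts G \<rightarrow> {..<k}. distinguishing_coloring G c)"

definition determining_set :: "('a, 'b) pre_digraph \<Rightarrow> 'a set \<Rightarrow> bool" where
  "determining_set G S \<longleftrightarrow>
     S \<subseteq> verts G \<and> (\<forall>\<phi> \<in> automorphisms G. (\<forall>v \<in> S. \<phi> v = v) \<longrightarrow> \<phi> = id)"

definition determining_number :: "('a, 'b) pre_digraph \<Rightarrow> nat" where
  "determining_number G = (LEAST k. \<exists>S. determining_set G S \<and> card S = k)"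

text \<open>
  The following two notions are meaningful for graphs with distinguishing number 2; then both
  classes of a distinguishing coloring with colors 0 and 1 are nonempty.
\<close>

definition distinguishing_class :: "('a, 'b) pre_digraph \<Rightarrow> 'a set \<Rightarrow> bool" where
  "distinguishing_class G S \<longleftrightarrow>
     (\<exists>c \<in> verts G \<rightarrow> {..<2::nat}. distinguishing_coloring G c \<and>
        (\<exists>i<2. S = {v \<in> verts G. c v = i}))"

definition cost_number :: "('a, 'b) pre_digraph \<Rightarrow> nat" where
  "cost_number G = (LEAST k. \<exists>S. distinguishing_class G S \<and> card S = k)"

end

theory Submission
  imports Defs
begin

text \<open>
  A distinguishing class is determining, which gives the lower bound. For the upper bound, suppose
  that every set of at most four vertices is preserved by a nontrivial automorphism, and let
  \<open>{a, b}\<close> be a determining set. The orbit of \<open>(a, b)\<close> under the automorphism group is then the arc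
  set of an undirected graph \<open>\<Gamma>\<close>, on whose arcs the group acts regularly. Small sets inducing an edge
  with an isolated vertex, a path, a claw or a paw in \<open>\<Gamma>\<close> show in turn that the automorphism
  swapping the ends of an edge of \<open>\<Gamma>\<close> fixes all vertices adjacent to neither end, that the ends of
  an induced path can be swapped, and that \<open>\<Gamma>\<close> has no induced claw or paw. Hence every neighbour of
  the middle vertex of an induced path, other than the two ends, is adjacent to both ends, which
  leaves three cases: the components of \<open>\<Gamma>\<close> are complete, \<open>\<Gamma>\<close> has an induced 4-cycle, or \<open>\<Gamma>\<close> is
  2-regular and contains a 5-cycle. In each of them every 2-coloring is preserved by a nontrivial
  automorphism: a transposition of twins, a product of two transpositions on the 4-cycle, or a
  reflection of the 5-cycle.
\<close>

section \<open>Automorphisms, determining sets and distinguishing classes\<close>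

lemma automorphisms_permutes: "h \<in> automorphisms G \<Longrightarrow> h permutes verts G"
  by (simp add: automorphisms_def)

lemma automorphisms_arcs:
  "h \<in> automorphisms G \<Longrightarrow> u \<in> verts G \<Longrightarrow> v \<in> verts G \<Longrightarrow> h u \<rightarrow>\<^bsub>G\<^esub> h v \<longleftrightarrow> u \<rightarrow>\<^bsub>G\<^esub> v"
  by (simp add: automorphisms_def)

lemma automorphisms_in_verts: "h \<in> automorphisms G \<Longrightarrow> h v \<in> verts G \<longleftrightarrow> v \<in> verts G"
  using permutes_in_image[OF automorphisms_permutes] .

lemma automorphisms_inj: "h \<in> automorphisms G \<Longrightarrow> h u = h v \<longleftrightarrow> u = v"
  using permutes_inj[OF automorphisms_permutes] by (auto dest: injD)

lemma id_automorphism: "id \<in> automorphisms G"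
  by (simp add: automorphisms_def permutes_id)

lemma comp_automorphism:
  assumes "g \<in> automorphisms G" "h \<in> automorphisms G"
  shows "g \<circ> h \<in> automorphisms G"
  using assms by (simp add: automorphisms_def permutes_compose permutes_in_image)

lemma inv_automorphism:
  assumes h: "h \<in> automorphisms G"
  shows "inv h \<in> automorphisms G"
proof -
  have p: "h permutes verts G" using h by (rule automorphisms_permutes)
  have "inv h u \<rightarrow>\<^bsub>G\<^esub> inv h v \<longleftrightarrow> u \<rightarrow>\<^bsub>G\<^esub> v" if "u \<in> verts G" "v \<in> verts G" for u v
    using automorphisms_arcs[OF h, of "inv h u" "inv h v"] that
    by (simp add: permutes_in_image[OF permutes_inv[OF p]] permutes_inverses[OF p])
  then show ?thesis using permutes_inv[OF p] by (simp add: automorphisms_def)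
qed

section \<open>Attained minima; determining sets and classes\<close>

text \<open>An injective coloring works, since an automorphism preserving it fixes every vertex.
  Hence the minimum in \<open>distinguishing_number\<close> is attained.\<close>

lemma distinguishing_coloring_exists:
  assumes "finite (verts G)"
  shows "\<exists>c \<in> verts G \<rightarrow> {..<card (verts G)}. distinguishing_coloring G c"
proof -
  obtain c :: "'a \<Rightarrow> nat" where c: "bij_betw c (verts G) {..<card (verts G)}"
    using ex_bij_betw_finite_nat[OF assms] by (auto simp: atLeast0LessThan)
  have "\<phi> = id" if "\<phi> \<in> automorphisms G" "\<forall>v\<in>verts G. c (\<phi> v) = c v" for \<phi>
  proof
    fix v
    show "\<phi> v = id v"
    proof (cases "v \<in> verts G")
      case True
      then show ?thesis
        using that bij_betw_imp_inj_on[OF c] by (auto simp: automorphisms_in_verts dest: inj_onD)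
    next
      case False
      then show ?thesis using permutes_not_in[OF automorphisms_permutes[OF that(1)]] by simp
    qed
  qed
  moreover have "c \<in> verts G \<rightarrow> {..<card (verts G)}"
    using bij_betwE[OF c] by blast
  ultimately show ?thesis by (auto simp: distinguishing_coloring_def)
qed

lemma determining_set_verts: "determining_set G (verts G)"
proof -
  have "\<phi> = id" if "\<phi> \<in> automorphisms G" "\<forall>v\<in>verts G. \<phi> v = v" for \<phi>
    using that permutes_not_in[OF automorphisms_permutes[OF that(1)]] by (metis id_apply ext)
  then show ?thesis by (simp add: determining_set_def)
qed

lemma determining_number_attained:
  obtains S where "determining_set G S" "card S = determining_number G"
proof -
  have "\<exists>k S. determining_set G S \<and> card S = k" using determining_set_verts by blast
  from LeastI_ex[OF this] show thesis using that unfolding determining_number_def by blast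
qed

lemma determining_number_le: "determining_set G S \<Longrightarrow> determining_number G \<le> card S"
  unfolding determining_number_def by (rule Least_le) blast

lemma distinguishing_number_attained:
  assumes "finite (verts G)"
  obtains c where "c \<in> verts G \<rightarrow> {..<distinguishing_number G}" "distinguishing_coloring G c"
proof -
  have "\<exists>k::nat. \<exists>c \<in> verts G \<rightarrow> {..<k}. distinguishing_coloring G c"
    using distinguishing_coloring_exists[OF assms] by blast
  from LeastI_ex[OF this] show thesis using that unfolding distinguishing_number_def by blast
qed

text \<open>Source of the lower bound. An automorphism fixing one class pointwise maps its
  complement into itself by injectivity, and with two colors the complement has a single
  color.\<close>

lemma distinguishing_class_determining:
  assumes "distinguishing_class G S"
  shows "determining_set G S"
proof -
  obtain c i where c: "c \<in> verts G \<rightarrow> {..<2::nat}" "distinguishing_coloring G c" "i < 2"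
    and S: "S = {v \<in> verts G. c v = i}"
    using assms by (auto simp: distinguishing_class_def)
  have "\<phi> = id" if \<phi>: "\<phi> \<in> automorphisms G" "\<forall>v\<in>S. \<phi> v = v" for \<phi>
  proof -
    have "c (\<phi> v) = c v" if v: "v \<in> verts G" for v
    proof (cases "v \<in> S")
      case True
      then show ?thesis using \<phi> by simp
    next
      case False
      then have "\<phi> v \<notin> S" using \<phi> automorphisms_inj[OF \<phi>(1)] by metis
      then have "c v \<noteq> i" "c (\<phi> v) \<noteq> i" "c v < 2" "c (\<phi> v) < 2"
        using False v S c(1) by (auto simp: automorphisms_in_verts[OF \<phi>(1)])
      then show ?thesis using c(3) by linarith
    qed
    then show ?thesis using c(2) \<phi>(1) by (auto simp: distinguishing_coloring_def)
  qed
  then show ?thesis using S by (auto simp: determining_set_def)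
qed

text \<open>Used contrapositively: a set of vertices smaller than the cost is not a class, so a
  nontrivial automorphism preserves it.\<close>

lemma distinguishing_class_if_rigid:
  assumes "S \<subseteq> verts G"
    and rigid: "\<And>h. h \<in> automorphisms G \<Longrightarrow> h ` S \<subseteq> S \<Longrightarrow> h = id"
  shows "distinguishing_class G S"
proof -
  define c :: "'a \<Rightarrow> nat" where "c = (\<lambda>v. if v \<in> S then 1 else 0)"
  have "\<phi> = id" if "\<phi> \<in> automorphisms G" "\<forall>v\<in>verts G. c (\<phi> v) = c v" for \<phi>
    using that assms(1) by (intro rigid) (auto simp: c_def split: if_splits)
  then have "distinguishing_coloring G c" by (auto simp: distinguishing_coloring_def)
  moreover have "c \<in> verts G \<rightarrow> {..<2}" by (auto simp: c_def)
  moreover have "S = {v \<in> verts G. c v = 1}" using assms(1) by (auto simp: c_def)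
  ultimately show ?thesis unfolding distinguishing_class_def by (intro bexI[of _ c] conjI exI[of _ 1]) auto
qed

section \<open>The orbital graph of a determining pair\<close>

text \<open>The situation to be refuted: \<open>single_not_determining\<close> comes from
  determining number 2, \<open>not_rigid\<close> from a cost above 4. Both concern the group alone;
  colorings enter only in the last section.\<close>

locale expensive_graph = graph G for G :: "('a, 'b) pre_digraph" +
  fixes a b :: 'a
  assumes base: "determining_set G {a, b}"
    and distinct: "a \<noteq> b"
    and single_not_determining: "v \<in> verts G \<Longrightarrow> \<not> determining_set G {v}"
    and not_rigid: "S \<subseteq> verts G \<Longrightarrow> card S \<le> 4 \<Longrightarrow>
          \<exists>h \<in> automorphisms G. h \<noteq> id \<and> h ` S \<subseteq> S"
begin

abbreviation A where "A \<equiv> automorphisms G"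

text \<open>The orbit is formed among all pairs of vertices, not only arcs of \<open>G\<close>. By
  \<open>arcs_const_on_adj\<close>, \<Gamma> lies in \<open>G\<close> or in its complement.\<close>

definition adj :: "'a \<Rightarrow> 'a \<Rightarrow> bool" (infix "\<sim>" 50) where
  "u \<sim> v \<longleftrightarrow> (\<exists>h\<in>A. h a = u \<and> h b = v)"

lemma adj_verts: "u \<sim> v \<Longrightarrow> u \<in> verts G" "u \<sim> v \<Longrightarrow> v \<in> verts G"
  using base by (auto simp: adj_def determining_set_def automorphisms_in_verts)

lemma adj_irrefl: "u \<sim> v \<Longrightarrow> u \<noteq> v"
  using distinct by (auto simp: adj_def automorphisms_inj)

lemma base_adj: "a \<sim> b"
  unfolding adj_def by (rule bexI[OF _ id_automorphism]) simp

lemma adj_aut: assumes "h \<in> A" shows "h u \<sim> h v \<longleftrightarrow> u \<sim> v"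
proof -
  have *: "g u \<sim> g v" if g: "g \<in> A" and uv: "u \<sim> v" for g u v
  proof -
    obtain k where "k \<in> A" "k a = u" "k b = v" using uv by (auto simp: adj_def)
    then have "g \<circ> k \<in> A" "(g \<circ> k) a = g u" "(g \<circ> k) b = g v"
      using comp_automorphism[OF g] by auto
    then show ?thesis unfolding adj_def by blast
  qed
  have "inv h (h w) = w" for w
    using automorphisms_permutes[OF assms] by (rule permutes_inverses)
  then show ?thesis using *[OF assms] *[OF inv_automorphism[OF assms], of "h u" "h v"] by auto
qed

lemma arc_transitive:
  assumes "u \<sim> v" "p \<sim> q"
  obtains h where "h \<in> A" "h u = p" "h v = q"
proof -
  obtain g h where g: "g \<in> A" "g a = u" "g b = v" and h: "h \<in> A" "h a = p" "h b = q"
    using assms by (auto simp: adj_def)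
  have "inv g (g w) = w" for w
    using automorphisms_permutes[OF g(1)] by (rule permutes_inverses)
  then have "(h \<circ> inv g) u = p" "(h \<circ> inv g) v = q" using g h by auto
  then show thesis using that comp_automorphism[OF h(1) inv_automorphism[OF g(1)]] by blast
qed

text \<open>Since \<open>{a, b}\<close> is determining, a nontrivial automorphism preserving it
  swaps its elements; transitivity carries this symmetry to every arc.\<close>

lemma adj_sym: assumes "u \<sim> v" shows "v \<sim> u"
proof -
  have "{a, b} \<subseteq> verts G" using base by (simp add: determining_set_def)
  moreover have "card {a, b} \<le> 4" by (simp add: card_insert_if)
  ultimately obtain h where h: "h \<in> A" "h \<noteq> id" "h ` {a, b} \<subseteq> {a, b}"
    using not_rigid by blast
  have "\<not> (h a = a \<and> h b = b)" using h base by (auto simp: determining_set_def)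
  then have "h a = b" "h b = a" using h(3) automorphisms_inj[OF h(1)] by auto
  then have "b \<sim> a" using h(1) by (auto simp: adj_def)
  then show ?thesis by (metis arc_transitive[OF base_adj assms] adj_aut)
qed

lemma adj_swap:
  assumes "u \<sim> v"
  obtains s where "s \<in> A" "s u = v" "s v = u"
  using arc_transitive[OF assms adj_sym[OF assms]] by blast

text \<open>Conjugation by an automorphism taking \<open>(a, b)\<close> to \<open>(u, v)\<close>
  reduces this to the base pair.\<close>

lemma fixes_arc_id:
  assumes "u \<sim> v" "h \<in> A" "h u = u" "h v = v"
  shows "h = id"
proof -
  obtain g where g: "g \<in> A" "g a = u" "g b = v" using assms(1) by (auto simp: adj_def)
  have p: "g permutes verts G" using g(1) by (rule automorphisms_permutes)
  have "(inv g \<circ> (h \<circ> g)) a = a" "(inv g \<circ> (h \<circ> g)) b = b"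
    using g assms permutes_inverses(2)[OF p] by auto
  moreover have "inv g \<circ> (h \<circ> g) \<in> A"
    using g(1) assms(2) by (intro comp_automorphism inv_automorphism)
  ultimately have e: "inv g \<circ> (h \<circ> g) = id" using base by (auto simp: determining_set_def)
  have "h w = w" for w
  proof -
    have "inv g (h (g (inv g w))) = inv g w" using fun_cong[OF e, of "inv g w"] by simp
    then show ?thesis using permutes_inverses[OF p] by metis
  qed
  then show ?thesis by auto
qed

lemma agree_on_arc:
  assumes "u \<sim> v" "g \<in> A" "h \<in> A" "g u = h u" "g v = h v"
  shows "g = h"
proof -
  have p: "h permutes verts G" using assms(3) by (rule automorphisms_permutes)
  have "inv h \<circ> g = id"
    using assms permutes_inverses(2)[OF p]
    by (intro fixes_arc_id[OF assms(1)] comp_automorphism inv_automorphism) auto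
  then show ?thesis using permutes_inverses(1)[OF p] by (metis comp_apply id_apply ext)
qed

lemma arcs_const_on_adj:
  assumes "u \<sim> v" "p \<sim> q" shows "u \<rightarrow>\<^bsub>G\<^esub> v \<longleftrightarrow> p \<rightarrow>\<^bsub>G\<^esub> q"
  by (metis arc_transitive[OF assms] automorphisms_arcs adj_verts[OF assms(1)])

text \<open>As \<open>{x}\<close> is not determining, some nontrivial automorphism fixes
  \<open>x\<close>. By regularity it moves \<open>y\<close>, necessarily to another neighbour of
  \<open>x\<close>.\<close>

lemma second_neighbour:
  assumes "x \<sim> y" obtains z where "x \<sim> z" "z \<noteq> y"
proof -
  obtain h where h: "h \<in> A" "h x = x" "h \<noteq> id"
    using single_not_determining adj_verts[OF assms] by (auto simp: determining_set_def)
  then have "h y \<noteq> y" using fixes_arc_id[OF assms] by blast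
  moreover have "x \<sim> h y" using adj_aut[OF h(1), of x y] h(2) assms by simp
  ultimately show thesis using that by blast
qed

section \<open>Induced subgraphs of \<Gamma> on at most four vertices\<close>

lemma not_rigid_4:
  assumes "{x, y, z, w} \<subseteq> verts G"
  obtains h where "h \<in> A" "h \<noteq> id" "h ` {x, y, z, w} \<subseteq> {x, y, z, w}"
proof -
  \<comment> \<open>The vertices may coincide; triples are treated below by repeating one.\<close>
  have "card {x, y, z, w} \<le> 4" by (simp add: card_insert_if)
  then show thesis using not_rigid[OF assms] that by blast
qed

text \<open>In \<open>{x, y, z}\<close> the only edge is \<open>xy\<close>, so the nontrivial
  \<open>h\<close> preserving this set swaps \<open>x\<close> and \<open>y\<close> and fixes
  \<open>z\<close>. By regularity \<open>h\<close> is \<open>s\<close>.\<close>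

lemma swap_fixes_nonneighbours:
  assumes xy: "x \<sim> y" and z: "z \<in> verts G" "\<not> x \<sim> z" "\<not> y \<sim> z" "z \<noteq> x" "z \<noteq> y"
    and s: "s \<in> A" "s x = y" "s y = x"
  shows "s z = z"
proof -
  obtain h where h: "h \<in> A" "h \<noteq> id" "h ` {x, y, z, z} \<subseteq> {x, y, z, z}"
    using not_rigid_4[of x y z z] adj_verts[OF xy] z(1) by auto
  have hxy: "h x \<sim> h y" using adj_aut[OF h(1)] xy by simp
  have "h x \<noteq> z" "h y \<noteq> z"
    using h(3) hxy adj_irrefl z adj_sym by auto
  then have "h x = x \<and> h y = y \<or> h x = y \<and> h y = x"
    using h(3) automorphisms_inj[OF h(1)] adj_irrefl[OF xy] by auto
  then have sw: "h x = y" "h y = x" using fixes_arc_id[OF xy h(1)] h(2) by auto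
  then have "h z = z" using h(3) automorphisms_inj[OF h(1)] z by auto
  moreover have "h = s" using agree_on_arc[OF xy h(1) s(1)] sw s by simp
  ultimately show ?thesis by simp
qed

text \<open>The middle \<open>x\<close> is the only vertex of degree 2 in the path, hence fixed by
  \<open>h\<close>; fixing an end as well would make \<open>h\<close> trivial.\<close>

lemma induced_path_swap:
  assumes "x \<sim> y" "x \<sim> z" "\<not> y \<sim> z" "y \<noteq> z"
  obtains t where "t \<in> A" "t x = x" "t y = z" "t z = y"
proof -
  obtain h where h: "h \<in> A" "h \<noteq> id" "h ` {x, y, z, z} \<subseteq> {x, y, z, z}"
    using not_rigid_4[of x y z z] adj_verts[OF assms(1)] adj_verts[OF assms(2)] by auto
  have i: "h u = h v \<longleftrightarrow> u = v" for u v using automorphisms_inj[OF h(1)] .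
  have e: "h x \<sim> h y" "h x \<sim> h z" using adj_aut[OF h(1)] assms by auto
  have n: "\<not> z \<sim> y" "x \<noteq> y" "x \<noteq> z" using assms adj_sym adj_irrefl by blast+
  have "\<And>u. \<not> u \<sim> u" using adj_irrefl by blast
  then have "h x \<noteq> y" "h x \<noteq> z"
    using h(3) e n assms i[of y z] by auto
  then have hx: "h x = x" using h(3) by auto
  have "h y = z" using fixes_arc_id[OF assms(1) h(1) hx] h(2,3) i[of x y] n hx by auto
  moreover have "h z = y" using fixes_arc_id[OF assms(2) h(1) hx] h(2,3) i[of x z] n hx by auto
  ultimately show thesis using that h(1) hx by blast
qed

lemma no_induced_claw:
  assumes "x \<sim> y" "x \<sim> z" "x \<sim> w" "\<not> y \<sim> z" "\<not> y \<sim> w" "\<not> z \<sim> w" "y \<noteq> z" "y \<noteq> w" "z \<noteq> w"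
  shows False
proof -
  obtain h where h: "h \<in> A" "h \<noteq> id" "h ` {x, y, z, w} \<subseteq> {x, y, z, w}"
    using not_rigid_4[of x y z w] assms(1-3) adj_verts by (metis insert_subset empty_subsetI)
  have i: "h u = h v \<longleftrightarrow> u = v" for u v using automorphisms_inj[OF h(1)] .
  have e: "h x \<sim> h y" "h x \<sim> h z" using adj_aut[OF h(1)] assms by auto
  have n: "\<not> z \<sim> y" "\<not> w \<sim> y" "\<not> w \<sim> z" "x \<noteq> y" "x \<noteq> z" "x \<noteq> w"
    using assms adj_sym adj_irrefl by blast+
  have "\<And>u. \<not> u \<sim> u" using adj_irrefl by blast
  then have "h x \<noteq> y" "h x \<noteq> z" "h x \<noteq> w"
    using h(3) e n assms i[of y z] by auto
  then have hx: "h x = x" using h(3) by auto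
  \<comment> \<open>By regularity on arcs, \<open>h\<close> is one of these two swaps, but each of them fixes a third leaf.\<close>
  obtain t where t: "t \<in> A" "t x = x" "t y = z" "t z = y"
    using induced_path_swap[OF assms(1,2,4,7)] .
  obtain t' where t': "t' \<in> A" "t' x = x" "t' y = w" "t' w = y"
    using induced_path_swap[OF assms(1,3,5,8)] .
  have "h y \<noteq> y" using fixes_arc_id[OF assms(1) h(1) hx] h(2) by blast
  then consider "h y = z" | "h y = w" using h(3) i[of x y] n hx by auto
  then show False
  proof cases
    case 1
    then have "h = t" using agree_on_arc[OF assms(1) h(1) t(1)] hx t by simp
    then have "h w = w" using h(3) t i[of w x] i[of w y] i[of w z] n assms(8,9) hx by auto
    then show False using fixes_arc_id[OF assms(3) h(1) hx] h(2) by blast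
  next
    case 2
    then have "h = t'" using agree_on_arc[OF assms(1) h(1) t'(1)] hx t' by simp
    then have "h z = z" using h(3) t' i[of z x] i[of z y] i[of z w] n assms(7,9) hx by auto
    then show False using fixes_arc_id[OF assms(2) h(1) hx] h(2) by blast
  qed
qed

text \<open>In the paw \<open>x\<close> is the only vertex of degree 3 and \<open>z\<close> the only
  one of degree 1. Both are fixed, and with them the arc \<open>(x, z)\<close>.\<close>

lemma no_induced_paw:
  assumes "x \<sim> y" "x \<sim> z" "x \<sim> w" "\<not> y \<sim> z" "y \<sim> w" "\<not> z \<sim> w" "y \<noteq> z" "z \<noteq> w"
  shows False
proof -
  obtain h where h: "h \<in> A" "h \<noteq> id" "h ` {x, y, z, w} \<subseteq> {x, y, z, w}"
    using not_rigid_4[of x y z w] assms(1-3) adj_verts by (metis insert_subset empty_subsetI)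
  have i: "h u = h v \<longleftrightarrow> u = v" for u v using automorphisms_inj[OF h(1)] .
  have e: "h x \<sim> h y" "h x \<sim> h z" "h x \<sim> h w" "h y \<sim> h w" using adj_aut[OF h(1)] assms by auto
  have n: "\<not> z \<sim> y" "\<not> w \<sim> z" "x \<noteq> y" "x \<noteq> z" "x \<noteq> w" "y \<noteq> w" "\<And>u. \<not> u \<sim> u"
    using assms adj_sym adj_irrefl by blast+
  have "h x \<noteq> y" "h x \<noteq> z" "h x \<noteq> w"
    using h(3) e n assms i[of y z] i[of y w] i[of z w] by auto
  then have hx: "h x = x" using h(3) by auto
  have "h z = z"
    using h(3) hx e n assms i[of y z] i[of y w] i[of z w] i[of x z] i[of x y] i[of x w] by auto
  then show False using fixes_arc_id[OF assms(2) h(1) hx] h(2) by blast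
qed

text \<open>If \<open>w\<close> were adjacent to neither end there would be an induced claw, if to
  exactly one an induced paw.\<close>

lemma induced_path_dominates:
  assumes "x \<sim> y" "x \<sim> z" "\<not> y \<sim> z" "y \<noteq> z" "x \<sim> w" "w \<noteq> y" "w \<noteq> z"
  shows "y \<sim> w" "z \<sim> w"
  using assms no_induced_claw[of x y z w] no_induced_paw[of x y z w] no_induced_paw[of x z y w]
    adj_sym by metis+

text \<open>The swap of \<open>x\<close> and \<open>y\<close> fixes \<open>z\<close>. This carries
  information from \<Gamma> back to the arcs of \<open>G\<close>.\<close>

lemma arcs_eq_nonneighbour:
  assumes "x \<sim> y" "z \<in> verts G" "\<not> x \<sim> z" "\<not> y \<sim> z" "z \<noteq> x" "z \<noteq> y"
  shows "z \<rightarrow>\<^bsub>G\<^esub> x \<longleftrightarrow> z \<rightarrow>\<^bsub>G\<^esub> y"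
proof -
  obtain s where s: "s \<in> A" "s x = y" "s y = x" using adj_swap[OF assms(1)] .
  have "s z = z" using swap_fixes_nonneighbours[OF assms s] .
  then show ?thesis using automorphisms_arcs[OF s(1) assms(2) adj_verts(1)[OF assms(1)]] s by simp
qed

section \<open>Automorphisms preserving a 2-coloring\<close>

lemma arcs_commute: "u \<rightarrow>\<^bsub>G\<^esub> v \<longleftrightarrow> v \<rightarrow>\<^bsub>G\<^esub> u"
  using sym_arcs by (auto simp: symmetric_def sym_def)

lemma no_loop_arc: "\<not> u \<rightarrow>\<^bsub>G\<^esub> u"
  using no_loops by (auto simp: arcs_ends_conv)

lemma twins_swap:
  assumes "u \<in> verts G" "v \<in> verts G"
    and tw: "\<And>w. w \<in> verts G \<Longrightarrow> w \<noteq> u \<Longrightarrow> w \<noteq> v \<Longrightarrow> w \<rightarrow>\<^bsub>G\<^esub> u \<longleftrightarrow> w \<rightarrow>\<^bsub>G\<^esub> v"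
  shows "transpose u v \<in> A"
proof -
  have tw': "u \<rightarrow>\<^bsub>G\<^esub> w \<longleftrightarrow> v \<rightarrow>\<^bsub>G\<^esub> w" if "w \<in> verts G" "w \<noteq> u" "w \<noteq> v" for w
    using tw[OF that] arcs_commute by blast
  have "transpose u v p \<rightarrow>\<^bsub>G\<^esub> transpose u v q \<longleftrightarrow> p \<rightarrow>\<^bsub>G\<^esub> q"
    if "p \<in> verts G" "q \<in> verts G" for p q
  proof (cases "p \<in> {u, v}"; cases "q \<in> {u, v}")
    assume "p \<in> {u, v}" "q \<in> {u, v}"
    then show ?thesis using arcs_commute[of v u]
      by (elim insertE emptyE) (simp_all add: no_loop_arc)
  qed (use tw[OF that(1)] tw'[OF that(2)] in \<open>auto simp: transpose_def\<close>)
  then show ?thesis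
    unfolding automorphisms_def using permutes_swap_id[OF assms(1,2)] by blast
qed

lemma twins_distinct_colors:
  assumes c: "distinguishing_coloring G c"
    and uv: "u \<in> verts G" "v \<in> verts G" "u \<noteq> v"
    and tw: "\<And>w. w \<in> verts G \<Longrightarrow> w \<noteq> u \<Longrightarrow> w \<noteq> v \<Longrightarrow> w \<rightarrow>\<^bsub>G\<^esub> u \<longleftrightarrow> w \<rightarrow>\<^bsub>G\<^esub> v"
  shows "c u \<noteq> c v"
proof
  assume eq: "c u = c v"
  have "transpose u v = id"
    using c twins_swap[OF uv(1,2) tw] eq by (auto simp: distinguishing_coloring_def transpose_def)
  then show False using uv(3) by (metis id_apply transpose_apply_first)
qed

section \<open>Complete components\<close>

text \<open>Adjacent vertices of \<Gamma> are twins in \<open>G\<close>: any other vertex is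
  adjacent in \<Gamma> to both or to neither.\<close>

lemma clique_distinct_colors:
  assumes cliques: "\<And>x y z. x \<sim> y \<Longrightarrow> x \<sim> z \<Longrightarrow> y \<noteq> z \<Longrightarrow> y \<sim> z"
    and c: "distinguishing_coloring G c" and uv: "u \<sim> v"
  shows "c u \<noteq> c v"
proof (rule twins_distinct_colors[OF c adj_verts[OF uv] adj_irrefl[OF uv]])
  fix w assume w: "w \<in> verts G" "w \<noteq> u" "w \<noteq> v"
  show "w \<rightarrow>\<^bsub>G\<^esub> u \<longleftrightarrow> w \<rightarrow>\<^bsub>G\<^esub> v"
  proof (cases "u \<sim> w \<or> v \<sim> w")
    case True
    then have "w \<sim> u" "w \<sim> v" using cliques uv w adj_sym by metis+
    then show ?thesis by (rule arcs_const_on_adj)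
  next
    case False
    then show ?thesis using arcs_eq_nonneighbour[OF uv] w by blast
  qed
qed

section \<open>Induced 4-cycles\<close>

definition induced_4_cycle :: "'a \<Rightarrow> 'a \<Rightarrow> 'a \<Rightarrow> 'a \<Rightarrow> bool" where
  "induced_4_cycle x y x' y' \<longleftrightarrow>
     x \<sim> y \<and> y \<sim> x' \<and> x' \<sim> y' \<and> y' \<sim> x \<and> \<not> x \<sim> x' \<and> \<not> y \<sim> y' \<and> x \<noteq> x' \<and> y \<noteq> y'"

lemma induced_4_cycle_rotate: "induced_4_cycle x y x' y' \<Longrightarrow> induced_4_cycle y x' y' x"
  unfolding induced_4_cycle_def using adj_sym[of x' x] by auto

lemma induced_4_cycle_reflect: "induced_4_cycle x y x' y' \<Longrightarrow> induced_4_cycle x y' x' y"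
  unfolding induced_4_cycle_def
  using adj_sym[of y' x] adj_sym[of x' y'] adj_sym[of y x'] adj_sym[of x y] adj_sym[of y' y] by auto

lemma induced_4_cycle_module:
  assumes C: "induced_4_cycle x y x' y'"
    and v: "v \<in> verts G" "v \<notin> {x, y, x', y'}"
  shows "v \<rightarrow>\<^bsub>G\<^esub> y \<longleftrightarrow> v \<rightarrow>\<^bsub>G\<^esub> x" "v \<rightarrow>\<^bsub>G\<^esub> x' \<longleftrightarrow> v \<rightarrow>\<^bsub>G\<^esub> x" "v \<rightarrow>\<^bsub>G\<^esub> y' \<longleftrightarrow> v \<rightarrow>\<^bsub>G\<^esub> x"
proof -
  \<comment> \<open>Each vertex of the cycle is the middle of an induced path, so adjacency to
    \<open>v\<close> spreads from it to its two neighbours, hence around the cycle.\<close>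
  have step: "q \<sim> v" "s \<sim> v" if "induced_4_cycle p q r s" "p \<sim> v" "v \<notin> {p, q, r, s}" for p q r s
    using induced_path_dominates[of p q s v] that adj_sym[of s p] unfolding induced_4_cycle_def by auto
  have all: "y \<sim> v \<and> x' \<sim> v \<and> y' \<sim> v \<and> x \<sim> v" if "x \<sim> v \<or> y \<sim> v \<or> x' \<sim> v \<or> y' \<sim> v"
    using that step C induced_4_cycle_rotate v(2) by (metis insert_iff)
  have "(v \<rightarrow>\<^bsub>G\<^esub> y \<longleftrightarrow> v \<rightarrow>\<^bsub>G\<^esub> x) \<and> (v \<rightarrow>\<^bsub>G\<^esub> x' \<longleftrightarrow> v \<rightarrow>\<^bsub>G\<^esub> x) \<and> (v \<rightarrow>\<^bsub>G\<^esub> y' \<longleftrightarrow> v \<rightarrow>\<^bsub>G\<^esub> x)"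
  proof (cases "x \<sim> v \<or> y \<sim> v \<or> x' \<sim> v \<or> y' \<sim> v")
    case True
    then have "v \<sim> x" "v \<sim> y" "v \<sim> x'" "v \<sim> y'" using all adj_sym by blast+
    then show ?thesis using arcs_const_on_adj by blast
  next
    case False
    then show ?thesis
      using arcs_eq_nonneighbour[of x y v] arcs_eq_nonneighbour[of y x' v]
        arcs_eq_nonneighbour[of x' y' v] C v unfolding induced_4_cycle_def by auto
  qed
  then show "v \<rightarrow>\<^bsub>G\<^esub> y \<longleftrightarrow> v \<rightarrow>\<^bsub>G\<^esub> x" "v \<rightarrow>\<^bsub>G\<^esub> x' \<longleftrightarrow> v \<rightarrow>\<^bsub>G\<^esub> x" "v \<rightarrow>\<^bsub>G\<^esub> y' \<longleftrightarrow> v \<rightarrow>\<^bsub>G\<^esub> x" by blast+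
qed

lemma induced_4_cycle_opposite_colors:
  assumes C: "induced_4_cycle x y x' y'" and c: "distinguishing_coloring G c"
  shows "c x \<noteq> c x'"
proof (rule twins_distinct_colors[OF c])
  have e: "y \<sim> x" "y \<sim> x'" "y' \<sim> x" "y' \<sim> x'"
    using C adj_sym unfolding induced_4_cycle_def by blast+
  show "x \<in> verts G" "x' \<in> verts G" using adj_verts e by blast+
  show "x \<noteq> x'" using C by (simp add: induced_4_cycle_def)
  fix w assume w: "w \<in> verts G" "w \<noteq> x" "w \<noteq> x'"
  show "w \<rightarrow>\<^bsub>G\<^esub> x \<longleftrightarrow> w \<rightarrow>\<^bsub>G\<^esub> x'"
  proof (cases "w = y \<or> w = y'")
    case True
    then show ?thesis using arcs_const_on_adj e by metis
  next
    case False
    then show ?thesis using induced_4_cycle_module[OF C w(1)] w by blast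
  qed
qed

text \<open>Diagonals are not edges of \<Gamma>, so arc-transitivity does not compare them directly.
  The swap of \<open>x\<close> and \<open>y\<close> does: it takes \<open>x'\<close> to a neighbour
  of \<open>x\<close> not adjacent to \<open>y\<close>, which by domination can only be
  \<open>y'\<close>.\<close>

lemma induced_4_cycle_diagonal_arcs:
  assumes C: "induced_4_cycle x y x' y'"
  shows "x \<rightarrow>\<^bsub>G\<^esub> x' \<longleftrightarrow> y \<rightarrow>\<^bsub>G\<^esub> y'"
proof -
  have e: "x \<sim> y" "y \<sim> x'" "x' \<sim> y'" "x \<sim> y'" "\<not> x \<sim> x'" "\<not> y \<sim> y'" "x \<noteq> x'" "y \<noteq> y'"
    using C adj_sym unfolding induced_4_cycle_def by blast+
  obtain s where s: "s \<in> A" "s x = y" "s y = x" using adj_swap[OF e(1)] .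
  have sx': "x \<sim> s x'" "\<not> y \<sim> s x'" "y \<noteq> s x'"
    using adj_aut[OF s(1), of y x'] adj_aut[OF s(1), of x x'] automorphisms_inj[OF s(1), of x x'] s e
    by auto
  have "s x' = y'"
  proof (rule ccontr)
    assume "s x' \<noteq> y'"
    then show False using induced_path_dominates[OF e(1) e(4) e(6) e(8) sx'(1)] sx' by auto
  qed
  then show ?thesis using automorphisms_arcs[OF s(1), of x x'] s adj_verts e(1,3) by metis
qed

lemma induced_4_cycle_adjacent_colors:
  assumes C: "induced_4_cycle x y x' y'" and c: "distinguishing_coloring G c"
    and cc: "c x = c y" "c x' = c y'"
  shows False
proof -
  have e: "x \<sim> y" "y \<sim> x'" "x' \<sim> y'" "y' \<sim> x" using C unfolding induced_4_cycle_def by blast+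
  have V: "x \<in> verts G" "y \<in> verts G" "x' \<in> verts G" "y' \<in> verts G" using adj_verts e by blast+
  have ne: "x \<noteq> y" "x \<noteq> x'" "x \<noteq> y'" "y \<noteq> x'" "y \<noteq> y'" "x' \<noteq> y'"
    using C e adj_irrefl unfolding induced_4_cycle_def by blast+
  \<comment> \<open>The reflection of the square exchanging the ends of two opposite sides.\<close>
  define f where "f = transpose x y \<circ> transpose x' y'"
  have f: "f x = y" "f y = x" "f x' = y'" "f y' = x'" "\<And>v. v \<notin> {x, y, x', y'} \<Longrightarrow> f v = v"
    using ne by (auto simp: f_def transpose_def)
  have p: "f permutes verts G" unfolding f_def by (intro permutes_compose permutes_swap_id V)
  have m: "w \<rightarrow>\<^bsub>G\<^esub> f v \<longleftrightarrow> w \<rightarrow>\<^bsub>G\<^esub> v"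
    if "w \<in> verts G" "w \<notin> {x, y, x', y'}" "v \<in> {x, y, x', y'}" for v w
    using induced_4_cycle_module[OF C that(1,2)] that(3) by (elim insertE emptyE) (simp_all add: f(1-4))
  have cyc: "f u \<rightarrow>\<^bsub>G\<^esub> f v \<longleftrightarrow> u \<rightarrow>\<^bsub>G\<^esub> v" if "u \<in> {x, y, x', y'}" "v \<in> {x, y, x', y'}" for u v
  proof -
    \<comment> \<open>These rules rewrite every side to the pair \<open>x\<close>, \<open>y\<close>
      and every diagonal to the pair \<open>x\<close>, \<open>x'\<close>.\<close>
    note sides = arcs_const_on_adj[OF _ e(1)]
    note diagonals = induced_4_cycle_diagonal_arcs[OF C, symmetric] arcs_commute[of x' x]
      arcs_commute[of y' y, unfolded induced_4_cycle_diagonal_arcs[OF C, symmetric]]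
    show ?thesis
      using that by (elim insertE emptyE)
        (simp_all add: f(1-4) no_loop_arc diagonals sides[OF e(2)] sides[OF e(3)] sides[OF e(4)]
          e[THEN adj_sym, THEN sides])
  qed
  have "f u \<rightarrow>\<^bsub>G\<^esub> f v \<longleftrightarrow> u \<rightarrow>\<^bsub>G\<^esub> v" if uv: "u \<in> verts G" "v \<in> verts G" for u v
  proof (cases "u \<in> {x, y, x', y'}"; cases "v \<in> {x, y, x', y'}")
    assume "u \<in> {x, y, x', y'}" "v \<notin> {x, y, x', y'}"
    then show ?thesis using m[of v u] uv f(5)[of v] arcs_commute by metis
  next
    assume "u \<notin> {x, y, x', y'}" "v \<in> {x, y, x', y'}"
    then show ?thesis using m[of u v] uv f(5)[of u] by metis
  qed (use cyc f(5) in simp_all)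
  then have "f \<in> A" using p by (simp add: automorphisms_def)
  moreover have "c (f v) = c v" for v
  proof (cases "v \<in> {x, y, x', y'}")
    case True
    then show ?thesis by (elim insertE emptyE) (simp_all add: f(1-4) cc)
  qed (simp add: f(5))
  ultimately have "f = id" using c by (simp add: distinguishing_coloring_def)
  then show False using f(1) ne(1) by simp
qed

section \<open>The 2-regular case and its 5-cycle\<close>

lemma degree_2_if_no_induced_4_cycle:
  assumes no: "\<And>x y x' y'. \<not> induced_4_cycle x y x' y'"
    and xy: "x \<sim> y" and xz: "x \<sim> z" and "\<not> y \<sim> z" "y \<noteq> z"
    and uv: "u \<sim> p" "u \<sim> q" "p \<noteq> q" "u \<sim> v"
  shows "v \<in> {p, q}"
proof -
  have N: "w \<in> {y, z}" if w: "x \<sim> w" for w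
  proof (rule ccontr)
    assume "w \<notin> {y, z}"
    then have "w \<noteq> y" "w \<noteq> z" by auto
    note d = induced_path_dominates[OF xy xz assms(4,5) w this]
    obtain s where s: "s \<in> A" "s x = y" "s y = x" using adj_swap[OF xy] .
    \<comment> \<open>The aim is the forbidden cycle \<open>x\<close>, \<open>y\<close>,
      \<open>x'\<close>, \<open>z\<close>. Its missing side \<open>x' z\<close> follows by
      domination, first along the path \<open>x\<close>, \<open>y\<close>, \<open>x'\<close>, then
      along \<open>x\<close>, \<open>w\<close>, \<open>x'\<close>.\<close>
    define x' where "x' = s z"
    have x': "y \<sim> x'" "\<not> x \<sim> x'" "x \<noteq> x'"
      using adj_aut[OF s(1), of x z] adj_aut[OF s(1), of y z] automorphisms_inj[OF s(1), of y z] s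
        assms(4,5) xz by (auto simp: x'_def)
    have "x' \<sim> w"
      using induced_path_dominates[of y x x' w] adj_sym xy x' d w adj_irrefl by metis
    then have "x' \<sim> z"
      using induced_path_dominates[of w x x' z] adj_sym xz x' d w adj_irrefl by metis
    then show False
      using no[of x y x' z] xy xz x' assms(4,5) adj_sym by (auto simp: induced_4_cycle_def)
  qed
  \<comment> \<open>Vertex-transitivity on the non-isolated vertices of \<Gamma> moves the bound
    from \<open>x\<close> to \<open>u\<close>.\<close>
  obtain h where h: "h \<in> A" "h u = x" using arc_transitive[OF uv(1) xy] by metis
  have "h p \<in> {y, z}" "h q \<in> {y, z}" "h v \<in> {y, z}"
    using N adj_aut[OF h(1), of u] h(2) uv by simp_all
  then show ?thesis using automorphisms_inj[OF h(1)] uv(3) by auto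
qed

text \<open>The swap of \<open>p\<close> and \<open>q\<close> also exchanges their other neighbours
  \<open>t\<close> and \<open>r\<close>. It fixes everything else, since by \<open>deg2\<close> no
  further vertex is adjacent to \<open>p\<close> or \<open>q\<close>.\<close>

lemma pentagon_reflection_colors:
  assumes deg2: "\<And>u p q v. u \<sim> p \<Longrightarrow> u \<sim> q \<Longrightarrow> p \<noteq> q \<Longrightarrow> u \<sim> v \<Longrightarrow> v \<in> {p, q}"
    and c: "distinguishing_coloring G c"
    and e: "p \<sim> q" "q \<sim> r" "r \<sim> s" "s \<sim> t" "t \<sim> p"
    and ne: "p \<noteq> r" "q \<noteq> s" "r \<noteq> t" "s \<noteq> p" "t \<noteq> q"
    and cc: "c p = c q" "c r = c t"
  shows False
proof -
  have e': "p \<sim> t" "q \<sim> p" using e adj_sym by blast+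
  obtain \<sigma> where \<sigma>: "\<sigma> \<in> A" "\<sigma> p = q" "\<sigma> q = p" using adj_swap[OF e(1)] .
  have "q \<sim> \<sigma> t" "p \<sim> \<sigma> r" using adj_aut[OF \<sigma>(1)] \<sigma> e(2) e'(1) by metis+
  then have "\<sigma> t \<in> {p, r}" "\<sigma> r \<in> {q, t}"
    using deg2[OF e'(2) e(2) ne(1)] deg2[OF e(1) e'(1)] ne(5) by auto
  then have rt: "\<sigma> t = r" "\<sigma> r = t"
    using automorphisms_inj[OF \<sigma>(1), of t q] automorphisms_inj[OF \<sigma>(1), of r p] \<sigma> ne by auto
  have "c (\<sigma> v) = c v" if v: "v \<in> verts G" for v
  proof (cases "v \<in> {p, q, r, t}")
    case True
    then show ?thesis using cc \<sigma> rt by auto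
  next
    case False
    then have "\<not> p \<sim> v" "\<not> q \<sim> v" using deg2[OF e'(2) e(2) ne(1)] deg2[OF e(1) e'(1)] ne(5) by auto
    then have "\<sigma> v = v" using swap_fixes_nonneighbours[OF e(1) v _ _ _ _ \<sigma>] False by blast
    then show ?thesis by simp
  qed
  then have "\<sigma> = id" using c \<sigma>(1) by (simp add: distinguishing_coloring_def)
  then show False using \<sigma>(2) adj_irrefl[OF e(1)] by simp
qed

text \<open>The swap \<open>h\<close> of \<open>x\<close> and \<open>y\<close> sends
  \<open>z\<close> to \<open>r\<close>. The second neighbour \<open>s\<close> of \<open>z\<close> is
  adjacent to neither \<open>x\<close> nor \<open>y\<close>, so \<open>h\<close> fixes it and turns
  the edge \<open>zs\<close> into \<open>rs\<close>, closing the pentagon.\<close>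

lemma pentagon_if_no_induced_4_cycle:
  assumes no: "\<And>x y x' y'. \<not> induced_4_cycle x y x' y'"
    and xy: "x \<sim> y" and xz: "x \<sim> z" and yz: "\<not> y \<sim> z" "y \<noteq> z"
  obtains r s where "y \<sim> r" "r \<sim> s" "s \<sim> z" "x \<noteq> r" "y \<noteq> s" "r \<noteq> z" "s \<noteq> x"
proof -
  note deg2 = degree_2_if_no_induced_4_cycle[OF no xy xz yz]
  obtain h where h: "h \<in> A" "h x = y" "h y = x" using adj_swap[OF xy] .
  define r where "r = h z"
  have r: "y \<sim> r" "\<not> x \<sim> r" "x \<noteq> r"
    using adj_aut[OF h(1), of x z] adj_aut[OF h(1), of y z] automorphisms_inj[OF h(1), of y z] h
      yz xz by (auto simp: r_def)
  have rz: "\<not> r \<sim> z"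
    using no[of x y r z] xy xz r yz adj_sym by (auto simp: induced_4_cycle_def)
  obtain s where s: "z \<sim> s" "s \<noteq> x" using second_neighbour[OF adj_sym[OF xz]] .
  have ne: "s \<noteq> y" "s \<noteq> r" "s \<noteq> z" using s yz rz adj_sym adj_irrefl by blast+
  have "\<not> x \<sim> s" using deg2[OF xy xz yz(2)] ne by blast
  moreover have "\<not> y \<sim> s" using deg2[OF adj_sym[OF xy] r(1,3)] s ne by blast
  ultimately have "h s = s"
    using swap_fixes_nonneighbours[OF xy adj_verts(2)[OF s(1)] _ _ s(2) ne(1) h] by blast
  then have "r \<sim> s" using adj_aut[OF h(1), of z s] s(1) r_def by simp
  then show thesis using that r s ne adj_sym xz by metis
qed

section \<open>Refutation of every 2-coloring\<close>

lemma not_2_distinguishable: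
  assumes col: "c \<in> verts G \<rightarrow> {..<2::nat}" and c: "distinguishing_coloring G c"
  shows False
proof -
  have two: "c u = c w" if "c u \<noteq> c v" "c w \<noteq> c v" "u \<in> verts G" "v \<in> verts G" "w \<in> verts G" for u v w
  proof -
    have "c u < 2" "c v < 2" "c w < 2" using col that by auto
    then show ?thesis using that by linarith
  qed
  consider (clique) "\<And>x y z. x \<sim> y \<Longrightarrow> x \<sim> z \<Longrightarrow> y \<noteq> z \<Longrightarrow> y \<sim> z"
    | (square) x y x' y' where "induced_4_cycle x y x' y'"
    | (path) x y z where "\<And>x y x' y'. \<not> induced_4_cycle x y x' y'" "x \<sim> y" "x \<sim> z" "\<not> y \<sim> z" "y \<noteq> z"
    by blast
  then show False
  proof cases
    case clique
    \<comment> \<open>A second neighbour of \<open>a\<close> yields a triangle, whose vertices would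
      need three colors.\<close>
    obtain z where z: "a \<sim> z" "z \<noteq> b" using second_neighbour[OF base_adj] .
    have bz: "b \<sim> z" using clique[OF base_adj z(1)] z(2) by blast
    have "c u \<noteq> c v" if "u \<sim> v" for u v
      by (rule clique_distinct_colors[OF _ c that]) (rule clique)
    then show False using z(1) base_adj bz two[of b a z] adj_verts by metis
  next
    case square
    have V: "x \<in> verts G" "y \<in> verts G" "x' \<in> verts G" "y' \<in> verts G"
      using square adj_verts unfolding induced_4_cycle_def by blast+
    have ne: "c x \<noteq> c x'" "c y \<noteq> c y'"
      using induced_4_cycle_opposite_colors[OF _ c] square induced_4_cycle_rotate[OF square] by blast+
    show False
    proof (cases "c x = c y")
      case True
      then show False using induced_4_cycle_adjacent_colors[OF square c] ne two V by metis
    next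
      case False
      then show False
        using induced_4_cycle_adjacent_colors[OF induced_4_cycle_reflect[OF square] c] ne two V by metis
    qed
  next
    case path
    obtain r s where rs: "y \<sim> r" "r \<sim> s" "s \<sim> z" "x \<noteq> r" "y \<noteq> s" "r \<noteq> z" "s \<noteq> x"
      using pentagon_if_no_induced_4_cycle[OF path] .
    have zx: "z \<sim> x" using path(3) adj_sym by blast
    \<comment> \<open>Each instance of \<open>R\<close> excludes one reflection of the pentagon;
      every 2-coloring of a 5-cycle is invariant under one of the five.\<close>
    have R: "\<not> (c p = c q \<and> c r = c t)"
      if "p \<sim> q" "q \<sim> r" "r \<sim> s" "s \<sim> t" "t \<sim> p" "p \<noteq> r" "q \<noteq> s" "r \<noteq> t" "s \<noteq> p" "t \<noteq> q" for p q r s t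
      using pentagon_reflection_colors[OF _ c that] degree_2_if_no_induced_4_cycle[OF path] by blast
    have "\<not> (c x = c y \<and> c r = c z)" by (rule R[of x y r s z]) (use rs path zx in auto)
    moreover have "\<not> (c y = c r \<and> c s = c x)" by (rule R[of y r s z x]) (use rs path zx in auto)
    moreover have "\<not> (c r = c s \<and> c z = c y)" by (rule R[of r s z x y]) (use rs path zx in auto)
    moreover have "\<not> (c s = c z \<and> c x = c r)" by (rule R[of s z x y r]) (use rs path zx in auto)
    moreover have "\<not> (c z = c x \<and> c y = c s)" by (rule R[of z x y r s]) (use rs path zx in auto)
    moreover have "c x < 2" "c y < 2" "c r < 2" "c s < 2" "c z < 2"
      using col adj_verts path(2,3) rs(1,2) by blast+
    ultimately show False by linarith
  qed
qed

end

theorem mainTheorem1: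
  fixes G :: "('a, 'b) pre_digraph"
  assumes "graph G"
    and "distinguishing_number G = 2"
    and "determining_number G = 2"
  shows "2 \<le> cost_number G \<and> cost_number G \<le> 4"
proof
  interpret graph G by fact
  obtain c where c: "c \<in> verts G \<rightarrow> {..<2::nat}" "distinguishing_coloring G c"
    using distinguishing_number_attained[OF finite_verts] assms(2) by metis
  have "distinguishing_class G {v \<in> verts G. c v = 0}"
    unfolding distinguishing_class_def using c zero_less_numeral by blast
  then have "\<exists>k S. distinguishing_class G S \<and> card S = k" by blast
  from LeastI_ex[OF this] obtain S where "distinguishing_class G S" "card S = cost_number G"
    unfolding cost_number_def by blast
  then show "2 \<le> cost_number G"
    using determining_number_le[OF distinguishing_class_determining] assms(3) by metis
  show "cost_number G \<le> 4"
  proof (rule ccontr)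
    assume big: "\<not> cost_number G \<le> 4"
    \<comment> \<open>A cost above 4 becomes the assumption \<open>not_rigid\<close>.\<close>
    have *: "\<exists>h \<in> automorphisms G. h \<noteq> id \<and> h ` S \<subseteq> S" if S: "S \<subseteq> verts G" "card S \<le> 4" for S
    proof (rule ccontr)
      assume "\<not> ?thesis"
      then have "distinguishing_class G S" using distinguishing_class_if_rigid[OF S(1)] by blast
      then have "cost_number G \<le> card S" unfolding cost_number_def by (intro Least_le) blast
      then show False using S(2) big by simp
    qed
    obtain D where D: "determining_set G D" "card D = 2"
      using determining_number_attained assms(3) by metis
    then obtain a b where ab: "D = {a, b}" "a \<noteq> b" by (auto simp: card_2_iff)
    have "\<not> determining_set G {v}" for v
      using determining_number_le[of G "{v}"] assms(3) by auto
    then interpret expensive_graph G a b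
      using D(1) ab * by unfold_locales auto
    show False using not_2_distinguishable[OF c] .
  qed
qed

end
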